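(* Let $u_x$, $v_y$ be univariate quasi-definite moment functionals and let $\rho$ satisfy the conditions of Case I or Case II of the context; in particular, for every $m\ge 0$ the moment functional $u^{(m)}_x=\rho(x)^{2m+1}u_x$ is quasi-definite. Let $w$ be the bivariate moment functional defined by $$\langle w, x^h y^k\rangle = \langle \rho(x)^{k+1}u_x, x^h\rangle\,\langle v_y, y^k\rangle,\qquad h,k\ge 0,$$ and linearity. For each $m\ge 0$ let $\{p^{(m)}_n(x)\}_{n\ge 0}$ be an orthogonal polynomial sequence for $u^{(m)}_x$, let $\{q_n(y)\}_{n\ge 0}$ be an orthogonal polynomial sequence for $v_y$, and define $$P_{n,m}(x,y)=p^{(m)}_{n-m}(x)\,\rho(x)^m\,q_m\!\left(\frac{y}{\rho(x)}\right),\qquad 0\le m\le n.$$ Then $w$ is quasi-definite, and $\{P_{n,m}(x,y): 0\le m\le n\}_{n\ge 0}$ constitutes a mutually orthogonal polynomial system with respect to $w$. Moreover, if $u^{(m)}_x$ (for all $m\ge 0$) and $v_y$ are positive definite, then $w$ is positive definite.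
   Context: **Univariate notions.** $\Pi$ is the space of real univariate polynomials. A (univariate) moment functional is a real linear functional on $\Pi$. An orthogonal polynomial sequence for a moment functional $u$ is a sequence $\{p_n\}_{n\ge0}\subset\Pi$ with $\deg p_n=n$ and $\langle u,p_np_m\rangle=h_n\delta_{n,m}$, where $h_n\ne 0$ for all $n$. The functional $u$ is quasi-definite if such a sequence exists, and positive definite if $\langle u,p^2\rangle>0$ for all $p\in\Pi$, $p\neq0$. A quasi-definite $u$ is symmetric if $\langle u,x^{2n+1}\rangle=0$ for all $n\ge0$ (then $p_n$ is even or odd according to the parity of $n$). Left multiplication is defined by $\langle q\,u,p\rangle=\langle u,qp\rangle$. **Conditions on $\rho$.** $u_x$, $v_y$ are quasi-definite moment functionals acting on the variables $x$, $y$ respectively, and $\rho(x)$ satisfies one of: - Case I: $\rho(x)=r_1x+r_0$ with $r_0,r_1\in\mathbb R$, $|r_1|+|r_0|>0$. - Case II: $\rho(x)$ is the square root of a nonzero real polynomial of degree at most $2$, and $v_y$ is symmetric. In both cases it is assumed that $u^{(m)}_x=\rho(x)^{2m+1}u_x$ is a quasi-definite moment functional for every $m\ge0$. In Case II, $u_x$ is understood to be a linear functional defined on $\Pi+\rho\,\Pi$, so that $\langle\rho^j u_x,p\rangle=\langle u_x,\rho^jp\rangle$ makes sense for all $j\ge 0$, $p\in\Pi$. In both cases $P_{n,m}$ is a polynomial in $(x,y)$ (in Case II because $q_m$ has the parity of $m$): if $q_m(t)=\sum_j c_jt^j$, then $\rho^mq_m(y/\rho)=\sum_j c_j\rho^{m-j}y^j$.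 **Bivariate notions.** $\Pi^2$ is the space of real polynomials in $x,y$; a bivariate moment functional is a real linear functional on $\Pi^2$. A polynomial system is a sequence of vectors $\mathbb P_n=(P_{n,0},\dots,P_{n,n})^t$, $n\ge0$, whose entries are independent polynomials of total degree $n$ (so that the entries of $\mathbb P_0,\dots,\mathbb P_n$ form a basis of the space of polynomials of total degree at most $n$). It is orthogonal with respect to $w$ if $\langle w,\mathbb P_n\mathbb P_m^t\rangle=0$ (entrywise) for $m\ne n$ and $\langle w,\mathbb P_n\mathbb P_n^t\rangle=H_n$ is a symmetric non-singular matrix; it is mutually orthogonal if in addition every $H_n$ is diagonal. $w$ is quasi-definite if an orthogonal polynomial system for $w$ exists, and positive definite if $\langle w,p^2\rangle>0$ for all $p\in\Pi^2$, $p\ne0$. *)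

theory Defs
  imports Complex_Main "HOL-Computational_Algebra.Polynomial" "Jordan_Normal_Form.Matrix"
begin

section \<open>Univariate moment functionals\<close>

definition moment_functional :: "(real poly \<Rightarrow> real) \<Rightarrow> bool" where
  "moment_functional u \<longleftrightarrow> Vector_Spaces.linear Polynomial.smult (*) u"

definition orthogonal_poly_seq :: "(real poly \<Rightarrow> real) \<Rightarrow> (nat \<Rightarrow> real poly) \<Rightarrow> bool" where
  "orthogonal_poly_seq u p \<longleftrightarrow>
     (\<forall>n. degree (p n) = n) \<and>
     (\<exists>h. (\<forall>n. h n \<noteq> 0) \<and> (\<forall>n m. u (p n * p m) = (if n = m then h n else 0)))"

definition quasi_definite :: "(real poly \<Rightarrow> real) \<Rightarrow> bool" where
  "quasi_definite u \<longleftrightarrow> moment_functional u \<and> (\<exists>p. orthogonal_poly_seq u p)"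

definition positive_definite :: "(real poly \<Rightarrow> real) \<Rightarrow> bool" where
  "positive_definite u \<longleftrightarrow> moment_functional u \<and> (\<forall>p. p \<noteq> 0 \<longrightarrow> u (p ^ 2) > 0)"

definition symmetric_functional :: "(real poly \<Rightarrow> real) \<Rightarrow> bool" where
  "symmetric_functional u \<longleftrightarrow> (\<forall>n. u (Polynomial.monom 1 (2 * n + 1)) = 0)"

section \<open>The function \<open>\<rho>\<close> and the functionals \<open>\<rho>\<^sup>j u\<close>\<close>

text \<open>
  In Case II the polynomial under the root may take negative values, so \<open>\<rho>\<close> is a
  complex-valued function of a real variable. Scalars and functionals remain real.
  Any function whose square is the given polynomial is admitted as its square root.
\<close>

definition case_I :: "(real \<Rightarrow> complex) \<Rightarrow> bool" where
  "case_I \<rho> \<longleftrightarrow>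
     (\<exists>r0 r1. \<bar>r1\<bar> + \<bar>r0\<bar> > 0 \<and> (\<forall>x. \<rho> x = complex_of_real (r1 * x + r0)))"

definition case_II :: "(real \<Rightarrow> complex) \<Rightarrow> (real poly \<Rightarrow> real) \<Rightarrow> bool" where
  "case_II \<rho> v \<longleftrightarrow>
     (\<exists>s :: real poly. s \<noteq> 0 \<and> degree s \<le> 2 \<and> (\<forall>x. \<rho> x ^ 2 = complex_of_real (poly s x))) \<and>
     symmetric_functional v"

text \<open>
  The space \<open>\<Pi> + \<rho> \<Pi>\<close>, as a real vector space of functions. In Case I it consists of
  the polynomial functions only, so there a functional on it is a moment functional.
\<close>

definition rho_space :: "(real \<Rightarrow> complex) \<Rightarrow> (real \<Rightarrow> complex) set" where
  "rho_space \<rho> =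
     {\<lambda>x. complex_of_real (poly p x) + \<rho> x * complex_of_real (poly q x) | p q. True}"

definition real_linear_on :: "(real \<Rightarrow> complex) set \<Rightarrow> ((real \<Rightarrow> complex) \<Rightarrow> real) \<Rightarrow> bool" where
  "real_linear_on V u \<longleftrightarrow>
     (\<forall>f\<in>V. \<forall>g\<in>V. u (\<lambda>x. f x + g x) = u f + u g) \<and>
     (\<forall>c :: real. \<forall>f\<in>V. u (\<lambda>x. complex_of_real c * f x) = c * u f)"

text \<open>\<open>\<langle>\<rho>\<^sup>j u, p\<rangle> = \<langle>u, \<rho>\<^sup>j p\<rangle>\<close>; for \<open>j = 0\<close> this is \<open>u\<close> itself as a functional on \<open>\<Pi>\<close>.\<close>

definition rho_pow_functional ::
    "(real \<Rightarrow> complex) \<Rightarrow> nat \<Rightarrow> ((real \<Rightarrow> complex) \<Rightarrow> real) \<Rightarrow> real poly \<Rightarrow> real" where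
  "rho_pow_functional \<rho> j u p = u (\<lambda>x. \<rho> x ^ j * complex_of_real (poly p x))"

section \<open>Bivariate polynomials and moment functionals\<close>

text \<open>
  A bivariate polynomial is a polynomial in \<open>y\<close> with coefficients in \<open>\<Pi>\<close>, the
  polynomials in \<open>x\<close>: the coefficient of \<open>x\<^sup>h y\<^sup>k\<close> in \<open>f\<close> is \<open>coeff (coeff f k) h\<close>.
\<close>

type_synonym bipoly = "real poly poly"

definition bi_monom :: "nat \<Rightarrow> nat \<Rightarrow> bipoly" where
  "bi_monom h k = Polynomial.monom (Polynomial.monom 1 h) k"

definition bi_eval :: "bipoly \<Rightarrow> real \<Rightarrow> real \<Rightarrow> real" where
  "bi_eval f x y = poly (poly f [:y:]) x"

definition bi_scale :: "real \<Rightarrow> bipoly \<Rightarrow> bipoly" where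
  "bi_scale c f = Polynomial.smult [:c:] f"

definition total_degree :: "bipoly \<Rightarrow> nat" where
  "total_degree f = Max (insert 0 {h + k | h k. poly.coeff (poly.coeff f k) h \<noteq> 0})"

definition bi_moment_functional :: "(bipoly \<Rightarrow> real) \<Rightarrow> bool" where
  "bi_moment_functional w \<longleftrightarrow> Vector_Spaces.linear bi_scale (*) w"

text \<open>
  Only the entries \<open>P n m\<close> with \<open>m \<le> n\<close> are relevant. Linear independence of the entries of
  each \<open>\<P>\<^sub>n\<close> separately would not suffice (\<open>x\<^sup>2\<close>, \<open>x\<^sup>2 + 1\<close>, \<open>x\<^sup>2 + x\<close>): the entries of
  \<open>\<P>\<^sub>0, \<dots>, \<P>\<^sub>n\<close> must form a basis of the polynomials of total degree at most \<open>n\<close>.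
\<close>

definition polynomial_system :: "(nat \<Rightarrow> nat \<Rightarrow> bipoly) \<Rightarrow> bool" where
  "polynomial_system P \<longleftrightarrow>
     (\<forall>n m. m \<le> n \<longrightarrow> total_degree (P n m) = n) \<and>
     (\<forall>N. let I = {(n, m). m \<le> n \<and> n \<le> N}; B = (\<lambda>(n, m). P n m) ` I in
        inj_on (\<lambda>(n, m). P n m) I \<and>
        \<not> module.dependent bi_scale B \<and>
        module.span bi_scale B = {f. total_degree f \<le> N})"

definition gram_mat :: "(bipoly \<Rightarrow> real) \<Rightarrow> (nat \<Rightarrow> nat \<Rightarrow> bipoly) \<Rightarrow> nat \<Rightarrow> real mat" where
  "gram_mat w P n = mat (n + 1) (n + 1) (\<lambda>(i, j). w (P n i * P n j))"

definition orthogonal_system :: "(bipoly \<Rightarrow> real) \<Rightarrow> (nat \<Rightarrow> nat \<Rightarrow> bipoly) \<Rightarrow> bool" where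
  "orthogonal_system w P \<longleftrightarrow>
     polynomial_system P \<and>
     (\<forall>n m i j. m \<noteq> n \<longrightarrow> i \<le> n \<longrightarrow> j \<le> m \<longrightarrow> w (P n i * P m j) = 0) \<and>
     (\<forall>n. transpose_mat (gram_mat w P n) = gram_mat w P n \<and> invertible_mat (gram_mat w P n))"

definition mutually_orthogonal_system ::
    "(bipoly \<Rightarrow> real) \<Rightarrow> (nat \<Rightarrow> nat \<Rightarrow> bipoly) \<Rightarrow> bool" where
  "mutually_orthogonal_system w P \<longleftrightarrow>
     orthogonal_system w P \<and> (\<forall>n. diagonal_mat (gram_mat w P n))"

definition bi_quasi_definite :: "(bipoly \<Rightarrow> real) \<Rightarrow> bool" where
  "bi_quasi_definite w \<longleftrightarrow> bi_moment_functional w \<and> (\<exists>P. orthogonal_system w P)"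

definition bi_positive_definite :: "(bipoly \<Rightarrow> real) \<Rightarrow> bool" where
  "bi_positive_definite w \<longleftrightarrow> bi_moment_functional w \<and> (\<forall>f. f \<noteq> 0 \<longrightarrow> w (f ^ 2) > 0)"

section \<open>The family \<open>P\<^sub>n\<^sub>,\<^sub>m\<close>\<close>

text \<open>
  \<open>P\<^sub>n\<^sub>,\<^sub>m(x, y) = p\<^sup>(\<^sup>m\<^sup>)\<^sub>n\<^sub>-\<^sub>m(x) \<rho>(x)\<^sup>m q\<^sub>m(y / \<rho>(x))\<close> wherever \<open>\<rho>(x) \<noteq> 0\<close>. As \<open>\<rho>\<close> has only
  finitely many zeros, this determines each polynomial \<open>P n m\<close> with \<open>m \<le> n\<close>.
\<close>

definition koornwinder_family ::
    "(real \<Rightarrow> complex) \<Rightarrow> (nat \<Rightarrow> nat \<Rightarrow> real poly) \<Rightarrow> (nat \<Rightarrow> real poly)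
       \<Rightarrow> (nat \<Rightarrow> nat \<Rightarrow> bipoly) \<Rightarrow> bool" where
  "koornwinder_family \<rho> p q P \<longleftrightarrow>
     (\<forall>n m x y. m \<le> n \<longrightarrow> \<rho> x \<noteq> 0 \<longrightarrow>
        complex_of_real (bi_eval (P n m) x y) =
          complex_of_real (poly (p m (n - m)) x) * \<rho> x ^ m *
          poly (map_poly complex_of_real (q m)) (complex_of_real y / \<rho> x))"

end

theory Submission
  imports Defs
begin

text \<open>
  The family separates the variables: \<open>w (P n m * P n' m')\<close> equals
  \<open>u (\<rho> ^ (m + m' + 1) * p m (n - m) * p m' (n' - m')) * v (q m * q m')\<close>. Orthogonality of \<open>q\<close>
  forces \<open>m = m'\<close>, and then orthogonality of \<open>p m\<close> forces \<open>n = n'\<close>. Linear independence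
  follows from orthogonality, spanning by eliminating the top coefficient in \<open>y\<close>, and
  positivity of \<open>w (f\<^sup>2)\<close> by expanding \<open>f\<close> in the family.
\<close>

hide_const (open) Module.smult

section \<open>Moment functionals\<close>

lemma moment_functional_iff:
  "moment_functional u \<longleftrightarrow>
     (\<forall>a b. u (a + b) = u a + u b) \<and> (\<forall>c a. u (smult c a) = c * u a)"
proof
  assume "moment_functional u"
  then interpret Vector_Spaces.linear smult "(*)" u
    by (simp add: moment_functional_def)
  show "(\<forall>a b. u (a + b) = u a + u b) \<and> (\<forall>c a. u (smult c a) = c * u a)"
    by (simp add: add scale)
next
  assume *: "(\<forall>a b. u (a + b) = u a + u b) \<and> (\<forall>c a. u (smult c a) = c * u a)"
  show "moment_functional u"
    unfolding moment_functional_def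
    by unfold_locales (use * in \<open>auto simp: algebra_simps smult_add_left smult_add_right\<close>)
qed

lemma moment_functional_add: "moment_functional u \<Longrightarrow> u (a + b) = u a + u b"
  and moment_functional_smult: "moment_functional u \<Longrightarrow> u (smult c a) = c * u a"
  by (auto simp: moment_functional_iff)

lemma moment_functional_0: "moment_functional u \<Longrightarrow> u 0 = 0"
  using moment_functional_smult[of u 0 0] by simp

lemma moment_functional_diff: "moment_functional u \<Longrightarrow> u (a - b) = u a - u b"
  using moment_functional_add[of u "a - b" b] by simp

lemma moment_functional_sum: "moment_functional u \<Longrightarrow> u (sum f A) = (\<Sum>x\<in>A. u (f x))"
  by (induction A rule: infinite_finite_induct)
     (auto simp: moment_functional_0 moment_functional_add)

lemma moment_functional_eqI:
  assumes "moment_functional f" "moment_functional g"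
    and "\<And>h. f (monom 1 h) = g (monom 1 h)"
  shows "f a = g a"
proof -
  have "f (\<Sum>i\<le>degree a. smult (poly.coeff a i) (monom 1 i)) =
      g (\<Sum>i\<le>degree a. smult (poly.coeff a i) (monom 1 i))"
    using assms by (simp only: moment_functional_smult moment_functional_sum)
  then show ?thesis
    by (simp add: smult_monom poly_as_sum_of_monoms)
qed

section \<open>Bivariate polynomials as a real vector space, and their total degree\<close>

interpretation bi: vector_space bi_scale
proof
  fix a b :: real and x y :: bipoly
  have "[:a + b:] = [:a:] + [:b:]" "[:a * b:] = [:a:] * [:b:]" by simp_all
  then show "bi_scale (a + b) x = bi_scale a x + bi_scale b x"
    "bi_scale a (bi_scale b x) = bi_scale (a * b) x"
    by (simp_all only: bi_scale_def smult_add_left smult_smult)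
qed (simp_all add: bi_scale_def smult_add_right flip: one_pCons)

lemma coeff_bi_scale: "poly.coeff (bi_scale c f) k = smult c (poly.coeff f k)"
  by (simp add: bi_scale_def)

lemma bi_scale_mult_left: "bi_scale c f * g = bi_scale c (f * g)"
  and bi_scale_mult_right: "f * bi_scale c g = bi_scale c (f * g)"
  by (simp_all add: bi_scale_def)

lemma
  assumes "bi_moment_functional w"
  shows bi_moment_functional_add: "w (f + g) = w f + w g"
    and bi_moment_functional_scale: "w (bi_scale c f) = c * w f"
    and bi_moment_functional_0: "w 0 = 0"
    and bi_moment_functional_sum: "w (sum F A) = (\<Sum>x\<in>A. w (F x))"
proof -
  interpret Vector_Spaces.linear bi_scale "(*)" w
    using assms by (simp add: bi_moment_functional_def)
  show "w (f + g) = w f + w g" "w (bi_scale c f) = c * w f" "w 0 = 0"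
    "w (sum F A) = (\<Sum>x\<in>A. w (F x))"
    by (simp_all add: add scale zero sum)
qed

text \<open>Only finitely many pairs carry a nonzero coefficient: \<open>k\<close> is bounded by the
  degree in y, and \<open>h\<close> by the largest degree among the coefficients in x. So
  \<open>Max\<close> ranges over a finite set, and the inserted 0 settles
  \<open>f = 0\<close>.\<close>

lemma total_degree_le_iff:
  "total_degree f \<le> N \<longleftrightarrow> (\<forall>h k. poly.coeff (poly.coeff f k) h \<noteq> 0 \<longrightarrow> h + k \<le> N)"
proof -
  let ?S = "{h + k | h k. poly.coeff (poly.coeff f k) h \<noteq> 0}"
  let ?M = "Max ((\<lambda>k. degree (poly.coeff f k)) ` {..degree f})"
  have "?S \<subseteq> {..?M + degree f}"
  proof clarify
    fix h k assume *: "poly.coeff (poly.coeff f k) h \<noteq> 0"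
    then have "poly.coeff f k \<noteq> 0" by auto
    then have k: "k \<le> degree f" by (rule le_degree)
    have "h \<le> degree (poly.coeff f k)" using * by (rule le_degree)
    also have "\<dots> \<le> ?M" using k by (intro Max_ge) auto
    finally show "h + k \<le> ?M + degree f" using k by simp
  qed
  then have "finite ?S" by (rule finite_subset) simp
  then show ?thesis unfolding total_degree_def by (subst Max_le_iff) auto
qed

lemma subspace_total_degree_le: "bi.subspace {f. total_degree f \<le> N}"
proof (rule bi.subspaceI)
  fix f g assume *: "f \<in> {f. total_degree f \<le> N}" "g \<in> {f. total_degree f \<le> N}"
  have "poly.coeff (poly.coeff f k) h \<noteq> 0 \<or> poly.coeff (poly.coeff g k) h \<noteq> 0"
    if "poly.coeff (poly.coeff (f + g) k) h \<noteq> 0" for h k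
    using that by auto
  then show "f + g \<in> {f. total_degree f \<le> N}"
    using * unfolding mem_Collect_eq total_degree_le_iff by blast
qed (auto simp: total_degree_le_iff coeff_bi_scale)

text \<open>Pairing a vanishing combination with a member \<open>b\<close> leaves only
  \<open>c b * w (b * b)\<close>. Positivity is not assumed, so nonvanishing of these squares
  replaces it.\<close>

lemma orthogonal_independent:
  assumes w: "bi_moment_functional w"
    and orth: "\<And>b b'. b \<in> B \<Longrightarrow> b' \<in> B \<Longrightarrow> b \<noteq> b' \<Longrightarrow> w (b * b') = 0"
    and nz: "\<And>b. b \<in> B \<Longrightarrow> w (b * b) \<noteq> 0"
  shows "\<not> bi.dependent B"
proof
  assume "bi.dependent B"
  then obtain S c b where S: "finite S" "S \<subseteq> B" "(\<Sum>x\<in>S. bi_scale (c x) x) = 0"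
    and b: "b \<in> S" "c b \<noteq> 0"
    unfolding bi.dependent_explicit by blast
  have "0 = w ((\<Sum>x\<in>S. bi_scale (c x) x) * b)"
    by (simp add: S bi_moment_functional_0[OF w])
  also have "\<dots> = (\<Sum>x\<in>S. c x * w (x * b))"
    by (simp add: sum_distrib_right bi_scale_mult_left bi_moment_functional_sum[OF w]
        bi_moment_functional_scale[OF w])
  also have "\<dots> = (\<Sum>x\<in>S. if x = b then c b * w (b * b) else 0)"
    using orth S b by (intro sum.cong) (auto simp: subset_iff)
  also have "\<dots> = c b * w (b * b)" using S b by simp
  finally show False using nz b S by auto
qed

text \<open>The cross terms in the expansion of \<open>f ^ 2\<close> vanish, leaving squares with
  positive weights; \<open>f \<noteq> 0\<close> supplies a nonzero coefficient.\<close>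

lemma orthogonal_span_positive:
  assumes w: "bi_moment_functional w" and "finite B" and f: "f \<in> bi.span B" "f \<noteq> 0"
    and orth: "\<And>b b'. b \<in> B \<Longrightarrow> b' \<in> B \<Longrightarrow> b \<noteq> b' \<Longrightarrow> w (b * b') = 0"
    and pos: "\<And>b. b \<in> B \<Longrightarrow> w (b * b) > 0"
  shows "w (f ^ 2) > 0"
proof -
  obtain c where c: "f = (\<Sum>x\<in>B. bi_scale (c x) x)"
    using f \<open>finite B\<close> by (auto simp: bi.span_finite)
  have "w (f ^ 2) = (\<Sum>x\<in>B. \<Sum>y\<in>B. c y * (c x * w (x * y)))"
    by (simp add: c power2_eq_square sum_product bi_scale_mult_left bi_scale_mult_right
        bi_moment_functional_sum[OF w] bi_moment_functional_scale[OF w]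
        del: bi.scale_scale)
  also have "\<dots> = (\<Sum>x\<in>B. \<Sum>y\<in>B. if x = y then (c x)\<^sup>2 * w (x * x) else 0)"
    using orth by (intro sum.cong) (auto simp: power2_eq_square)
  also have "\<dots> = (\<Sum>x\<in>B. (c x)\<^sup>2 * w (x * x))"
    using \<open>finite B\<close> by simp
  also have "\<dots> > 0"
  proof -
    obtain b where "b \<in> B" "c b \<noteq> 0"
      using f(2) c by (metis (no_types, lifting) bi.scale_zero_left sum.neutral)
    then show ?thesis
      using pos \<open>finite B\<close> by (intro sum_pos2[of _ b]) (auto simp: less_imp_le)
  qed
  finally show ?thesis .
qed

section \<open>Univariate orthogonal polynomials\<close>

text \<open>Induction on the degree bound: a multiple \<open>d\<close> of \<open>b (Suc N)\<close>
  cancels the top coefficient of \<open>f\<close>. Since the zero polynomial also has degree 0,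
  \<open>b 0 \<noteq> 0\<close> is a separate assumption.\<close>

lemma poly_graded_basis_expand:
  fixes b :: "nat \<Rightarrow> 'a::field poly"
  assumes deg: "\<And>n. degree (b n) = n" and b0: "b 0 \<noteq> 0" and f: "degree f \<le> N"
  shows "\<exists>c. f = (\<Sum>i\<le>N. smult (c i) (b i))"
  using f
proof (induction N arbitrary: f)
  case 0
  obtain \<beta> where \<beta>: "b 0 = [:\<beta>:]" using deg[of 0] by (metis degree_eq_zeroE)
  obtain \<phi> where "f = [:\<phi>:]" using 0 by (metis degree_eq_zeroE le_zero_eq)
  then show ?case using b0 \<beta> by (intro exI[of _ "\<lambda>_. \<phi> / \<beta>"]) auto
next
  case (Suc N)
  have nz: "poly.coeff (b (Suc N)) (Suc N) \<noteq> 0"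
    using deg[of "Suc N"] by (metis degree_0 leading_coeff_0_iff nat.distinct(1))
  define d where "d = poly.coeff f (Suc N) / poly.coeff (b (Suc N)) (Suc N)"
  have "degree (f - smult d (b (Suc N))) \<le> N"
  proof (rule degree_le, clarify)
    fix i assume "N < i"
    then show "poly.coeff (f - smult d (b (Suc N))) i = 0"
      using nz Suc.prems deg[of "Suc N"]
      by (cases "i = Suc N") (auto simp: d_def coeff_eq_0)
  qed
  then obtain c where c: "f - smult d (b (Suc N)) = (\<Sum>i\<le>N. smult (c i) (b i))"
    using Suc.IH by blast
  have "f = (\<Sum>i\<le>Suc N. smult ((c(Suc N := d)) i) (b i))"
    using c by (auto simp: algebra_simps)
  then show ?case by blast
qed

lemma
  assumes u: "moment_functional u" and p: "orthogonal_poly_seq u p"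
  shows orthogonal_poly_seq_degree: "degree (p n) = n"
    and orthogonal_poly_seq_orth: "i \<noteq> j \<Longrightarrow> u (p i * p j) = 0"
    and orthogonal_poly_seq_norm: "u (p n * p n) \<noteq> 0"
    and orthogonal_poly_seq_nonzero: "p n \<noteq> 0"
proof -
  show "degree (p n) = n" "i \<noteq> j \<Longrightarrow> u (p i * p j) = 0" and *: "u (p n * p n) \<noteq> 0"
    using p by (auto simp: orthogonal_poly_seq_def)
  show "p n \<noteq> 0" using * moment_functional_0[OF u] by auto
qed

lemma orthogonal_poly_seq_expand:
  assumes "moment_functional u" "orthogonal_poly_seq u p" "degree f \<le> N"
  shows "\<exists>c. f = (\<Sum>i\<le>N. smult (c i) (p i))"
  using assms
  by (intro poly_graded_basis_expand)
     (auto dest: orthogonal_poly_seq_degree orthogonal_poly_seq_nonzero)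

lemma orthogonal_poly_seq_lower_degree:
  assumes u: "moment_functional u" and p: "orthogonal_poly_seq u p" and f: "degree f < n"
  shows "u (p n * f) = 0"
proof -
  obtain c where c: "f = (\<Sum>i\<le>degree f. smult (c i) (p i))"
    using orthogonal_poly_seq_expand[OF u p order_refl] by blast
  have "u (p n * f) = (\<Sum>i\<le>degree f. c i * u (p n * p i))"
    by (subst c) (simp add: sum_distrib_left moment_functional_sum[OF u] moment_functional_smult[OF u])
  also have "\<dots> = 0"
    using f orthogonal_poly_seq_orth[OF u p] by (intro sum.neutral) auto
  finally show ?thesis .
qed

text \<open>Pairing the expansion of \<open>f\<close> with \<open>p j\<close> isolates the j-th
  coefficient times a nonzero norm. This serves as the uniqueness principle behind the parity of
  \<open>q m\<close>.\<close>

lemma orthogonal_poly_seq_eq_0I: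
  assumes u: "moment_functional u" and p: "orthogonal_poly_seq u p" and f: "degree f < n"
    and orth: "\<And>i. i < n \<Longrightarrow> u (f * p i) = 0"
  shows "f = 0"
proof -
  obtain c where c: "f = (\<Sum>i\<le>degree f. smult (c i) (p i))"
    using orthogonal_poly_seq_expand[OF u p order_refl] by blast
  have "c j = 0" if j: "j \<le> degree f" for j
  proof -
    have "0 = u (f * p j)" using orth f j by simp
    also have "\<dots> = (\<Sum>i\<le>degree f. c i * u (p i * p j))"
      by (subst c)
         (simp add: sum_distrib_right moment_functional_sum[OF u] moment_functional_smult[OF u])
    also have "\<dots> = (\<Sum>i\<le>degree f. if i = j then c j * u (p j * p j) else 0)"
      using orthogonal_poly_seq_orth[OF u p] by (intro sum.cong) auto
    also have "\<dots> = c j * u (p j * p j)" using j by simp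
    finally show ?thesis using orthogonal_poly_seq_norm[OF u p] by simp
  qed
  then show ?thesis by (subst c) simp
qed

text \<open>Substituting -x fixes even monomials and negates odd ones, whose moments vanish by
  symmetry.\<close>

lemma moment_functional_reflect:
  assumes v: "moment_functional v" and sym: "symmetric_functional v"
  shows "v (pcompose f [:0, -1:]) = v f"
proof (rule moment_functional_eqI[of "\<lambda>f. v (pcompose f [:0, -1:])" v])
  show "moment_functional (\<lambda>f. v (pcompose f [:0, -1:]))"
    unfolding moment_functional_iff
    by (simp add: pcompose_add pcompose_smult moment_functional_add[OF v] moment_functional_smult[OF v])
  fix h
  have *: "pcompose (monom (1::real) h) [:0, -1:] = smult ((-1) ^ h) (monom 1 h)"
    by (rule poly_eqI) (simp add: coeff_pcompose_linear)
  show "v (pcompose (monom 1 h) [:0, -1:]) = v (monom 1 h)"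
  proof (cases "even h")
    case False
    then have "v (monom 1 h) = 0"
      using sym by (auto simp: symmetric_functional_def elim!: oddE)
    then show ?thesis by (simp add: * moment_functional_smult[OF v])
  qed (simp add: *)
qed (rule v)

text \<open>The polynomials \<open>q m\<close> and (-1)^m times its reflection have the same leading
  coefficient and are both orthogonal to all lower degrees. Hence their difference \<open>g\<close>
  is zero.\<close>

lemma symmetric_orthogonal_poly_parity:
  assumes v: "moment_functional v" and q: "orthogonal_poly_seq v q" and sym: "symmetric_functional v"
    and odd: "j \<le> m" "odd (m - j)"
  shows "poly.coeff (q m) j = 0"
proof -
  note deg = orthogonal_poly_seq_degree[OF v q]
  let ?r = "\<lambda>f. pcompose f [:0, -1::real:]"
  have deg_r: "degree (?r f) = degree f" for f by (simp add: degree_pcompose)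
  define g where "g = q m - smult ((-1) ^ m) (?r (q m))"
  have cg: "poly.coeff g i = (1 - (-1) ^ m * (-1) ^ i) * poly.coeff (q m) i" for i
    by (simp add: g_def coeff_pcompose_linear algebra_simps)
  have "m > 0" using odd by (cases m) auto
  have "degree g \<le> m - 1"
  proof (rule degree_le, clarify)
    fix i assume "m - 1 < i"
    then show "poly.coeff g i = 0"
      using deg[of m] by (cases "i = m") (auto simp: cg coeff_eq_0 simp flip: power_mult_distrib)
  qed
  then have "degree g < m" using \<open>m > 0\<close> by simp
  moreover have "v (g * q i) = 0" if "i < m" for i
  proof -
    have invol: "?r (?r f) = f" for f
      by (rule poly_eqI) (simp add: coeff_pcompose_linear flip: mult.assoc power_mult_distrib)
    \<comment> \<open>Invariance of \<open>v\<close> moves the reflection onto \<open>q i\<close>,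
      which keeps its degree below \<open>m\<close>.\<close>
    have "v (?r (q m) * q i) = v (?r (q m * ?r (q i)))"
      by (simp add: pcompose_mult invol)
    also have "\<dots> = v (q m * ?r (q i))"
      by (rule moment_functional_reflect[OF v sym])
    also have "\<dots> = 0"
      using that by (intro orthogonal_poly_seq_lower_degree[OF v q]) (simp only: deg_r deg)
    finally have "v (?r (q m) * q i) = 0" .
    moreover have "v (q m * q i) = 0"
      using that orthogonal_poly_seq_orth[OF v q] by simp
    ultimately show ?thesis
      by (simp add: g_def left_diff_distrib moment_functional_diff[OF v] moment_functional_smult[OF v])
  qed
  ultimately have "g = 0" by (rule orthogonal_poly_seq_eq_0I[OF v q])
  \<comment> \<open>For opposite parities the factor in \<open>cg\<close> equals 2, so
    \<open>g = 0\<close> kills the coefficient.\<close>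
  moreover have "(-1::real) ^ m * (-1) ^ j = -1"
  proof -
    have "odd (m + j)" using odd by auto
    then show ?thesis by (simp flip: power_add)
  qed
  ultimately show ?thesis using cg[of j] by simp
qed

section \<open>The bivariate family\<close>

text \<open>For fixed y the difference has infinitely many roots in x and so vanishes. As a
  polynomial over the ring of polynomials in x it then has every constant \<open>[:y:]\<close> as a
  root.\<close>

lemma bi_eval_eqI:
  assumes "infinite X" and eq: "\<And>x y. x \<in> X \<Longrightarrow> bi_eval f x y = bi_eval g x y"
  shows "f = g"
proof -
  define d where "d = f - g"
  have "poly d [:y:] = 0" for y
  proof (rule ccontr)
    assume "poly d [:y:] \<noteq> 0"
    then have "finite {x. poly (poly d [:y:]) x = 0}" by (rule poly_roots_finite)
    moreover have "X \<subseteq> {x. poly (poly d [:y:]) x = 0}"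
      using eq by (auto simp: d_def bi_eval_def)
    ultimately show False using \<open>infinite X\<close> finite_subset by blast
  qed
  then have "range (\<lambda>y. [:y:]) \<subseteq> {a. poly d a = 0}" by auto
  moreover have "infinite (range (\<lambda>y::real. [:y:]))"
    using infinite_UNIV_char_0 by (auto simp: finite_image_iff inj_on_def)
  ultimately have "d = 0" using poly_roots_finite[of d] finite_subset by blast
  then show ?thesis by (simp add: d_def)
qed

text \<open>
  \<open>R i\<close> represents \<open>\<rho> ^ i\<close> as a polynomial, but only for those \<open>i\<close> that occur in some \<open>P n m\<close>: in
  Case II these are the even ones, by the parity of \<open>q m\<close>.
\<close>

locale koornwinder =
  fixes u :: "(real \<Rightarrow> complex) \<Rightarrow> real"
    and v :: "real poly \<Rightarrow> real"
    and \<rho> :: "real \<Rightarrow> complex"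
    and w :: "bipoly \<Rightarrow> real"
    and p :: "nat \<Rightarrow> nat \<Rightarrow> real poly"
    and q :: "nat \<Rightarrow> real poly"
    and R :: "nat \<Rightarrow> real poly"
  assumes u_linear: "real_linear_on (rho_space \<rho>) u"
    and v_linear: "moment_functional v"
    and w_linear: "bi_moment_functional w"
    and w_monom: "\<And>h k. w (bi_monom h k) =
          rho_pow_functional \<rho> (k + 1) u (monom 1 h) * v (monom 1 k)"
    and p_ops: "\<And>m. orthogonal_poly_seq (rho_pow_functional \<rho> (2 * m + 1) u) (p m)"
    and q_ops: "orthogonal_poly_seq v q"
    and rho_power_mem: "\<And>k a. (\<lambda>x. \<rho> x ^ k * complex_of_real (poly a x)) \<in> rho_space \<rho>"
    and finite_rho_zeros: "finite {x. \<rho> x = 0}"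
    and R_eval: "\<And>m j x. j \<le> m \<Longrightarrow> poly.coeff (q m) j \<noteq> 0 \<Longrightarrow>
          complex_of_real (poly (R (m - j)) x) = \<rho> x ^ (m - j)"
    and R_degree: "\<And>m j. j \<le> m \<Longrightarrow> poly.coeff (q m) j \<noteq> 0 \<Longrightarrow> degree (R (m - j)) \<le> m - j"
begin

abbreviation L where "L k \<equiv> rho_pow_functional \<rho> k u"

text \<open>The explicit form of \<open>P n m\<close>: multiplying out \<rho>^m q_m(y/\<rho>) turns
  the j-th term into c_j \<rho>^(m-j) y^j. Where c_j = 0, the value of \<open>R (m - j)\<close> is
  irrelevant.\<close>

definition K :: "nat \<Rightarrow> nat \<Rightarrow> bipoly" where
  "K n m = (\<Sum>j\<le>m. monom (smult (poly.coeff (q m) j) (p m (n - m) * R (m - j))) j)"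

text \<open>By \<open>rho_power_mem\<close> every function fed to \<open>u\<close> lies in the space
  on which \<open>u\<close> is linear.\<close>

lemma moment_functional_L: "moment_functional (L k)"
proof -
  let ?e = "\<lambda>a x. \<rho> x ^ k * complex_of_real (poly a x)"
  have "?e (a + b) = (\<lambda>x. ?e a x + ?e b x)" "?e (smult c a) = (\<lambda>x. complex_of_real c * ?e a x)" for a b c
    by (simp_all add: algebra_simps)
  moreover have "u (\<lambda>x. ?e a x + ?e b x) = u (?e a) + u (?e b)"
    "u (\<lambda>x. complex_of_real c * ?e a x) = c * u (?e a)" for a b c
    using u_linear rho_power_mem[of k] unfolding real_linear_on_def by simp_all
  ultimately show ?thesis
    unfolding moment_functional_iff rho_pow_functional_def by simp
qed

lemmas p_degree = orthogonal_poly_seq_degree[OF moment_functional_L p_ops]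
  and p_orth = orthogonal_poly_seq_orth[OF moment_functional_L p_ops]
  and p_norm = orthogonal_poly_seq_norm[OF moment_functional_L p_ops]
  and p_nonzero = orthogonal_poly_seq_nonzero[OF moment_functional_L p_ops]
  and q_degree = orthogonal_poly_seq_degree[OF v_linear q_ops]
  and q_orth = orthogonal_poly_seq_orth[OF v_linear q_ops]
  and q_norm = orthogonal_poly_seq_norm[OF v_linear q_ops]
  and q_nonzero = orthogonal_poly_seq_nonzero[OF v_linear q_ops]

lemma q_lead: "poly.coeff (q m) m \<noteq> 0"
  using q_degree[of m] q_nonzero[of m] by (metis leading_coeff_0_iff)

lemma q_as_sum: "q m = (\<Sum>i\<le>m. monom (poly.coeff (q m) i) i)"
  using poly_as_sum_of_monoms'[of "q m" m] q_degree by simp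

text \<open>The leading coefficient of \<open>q 0\<close> is nonzero, so \<open>R_eval\<close>
  controls the exponent 0.\<close>

lemma R_0: "R 0 = 1"
proof -
  have "complex_of_real (poly (R 0) x) = 1" for x
    using R_eval[of 0 0 x] q_lead[of 0] by simp
  then show ?thesis by (intro poly_eqI_degree[of UNIV] poly_ext) (auto simp: poly_eq_poly_eq_iff[symmetric])
qed

text \<open>For fixed \<open>k\<close> both sides are moment functionals in \<open>a\<close>, so the
  given moments of \<open>w\<close> determine them.\<close>

lemma w_monom_y: "w (monom a k) = L (k + 1) a * v (monom 1 k)"
proof (rule moment_functional_eqI[of "\<lambda>a. w (monom a k)"])
  have "monom (smult c a) k = bi_scale c (monom a k)" for c a
    by (simp add: bi_scale_def smult_monom)
  then show "moment_functional (\<lambda>a. w (monom a k))"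
    by (simp add: moment_functional_iff bi_moment_functional_add[OF w_linear]
        bi_moment_functional_scale[OF w_linear] flip: add_monom)
  show "moment_functional (\<lambda>a. L (k + 1) a * v (monom 1 k))"
    using moment_functional_L by (simp add: moment_functional_iff algebra_simps)
qed (use w_monom in \<open>simp add: bi_monom_def\<close>)

text \<open>The powers of \<open>\<rho>\<close> in the two factors and in the moments of \<open>w\<close> always add up to
  \<open>m + m' + 1\<close>, which separates the variables.\<close>

lemma w_K_mult:
  "w (K n m * K n' m') = L (m + m' + 1) (p m (n - m) * p m' (n' - m')) * v (q m * q m')"
proof -
  let ?a = "p m (n - m)" and ?b = "p m' (n' - m')"
  let ?c = "\<lambda>i. poly.coeff (q m) i" and ?d = "\<lambda>i. poly.coeff (q m') i"
  have "w (K n m * K n' m') =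
      (\<Sum>i\<le>m. \<Sum>j\<le>m'. w (monom (smult (?c i) (?a * R (m - i)) * smult (?d j) (?b * R (m' - j))) (i + j)))"
    unfolding K_def sum_product mult_monom bi_moment_functional_sum[OF w_linear] ..
  also have "\<dots> = (\<Sum>i\<le>m. \<Sum>j\<le>m'. L (m + m' + 1) (?a * ?b) * (?c i * ?d j * v (monom 1 (i + j))))"
  proof (intro sum.cong refl)
    fix i j assume ij: "i \<in> {..m}" "j \<in> {..m'}"
    show "w (monom (smult (?c i) (?a * R (m - i)) * smult (?d j) (?b * R (m' - j))) (i + j)) =
        L (m + m' + 1) (?a * ?b) * (?c i * ?d j * v (monom 1 (i + j)))"
    \<comment> \<open>A zero coefficient makes both sides vanish; this covers the exponents at which
      \<open>R\<close> need not represent a power of \<rho>.\<close>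
    proof (cases "?c i = 0 \<or> ?d j = 0")
      case True
      then show ?thesis by (auto simp: bi_moment_functional_0[OF w_linear])
    next
      case False
      have "m + m' + 1 = (m - i) + (m' - j) + (i + j + 1)" using ij by simp
      then have pow: "\<rho> x ^ (m + m' + 1) = \<rho> x ^ (m - i) * \<rho> x ^ (m' - j) * \<rho> x ^ (i + j + 1)" for x
        by (simp only: power_add)
      have "L (i + j + 1) (?a * R (m - i) * (?b * R (m' - j))) = L (m + m' + 1) (?a * ?b)"
        unfolding rho_pow_functional_def pow
        using False ij R_eval by (simp add: mult_ac)
      then show ?thesis
        by (simp add: w_monom_y moment_functional_smult[OF moment_functional_L])
    qed
  qed
  also have "\<dots> = L (m + m' + 1) (?a * ?b) * (\<Sum>i\<le>m. \<Sum>j\<le>m'. ?c i * ?d j * v (monom 1 (i + j)))"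
    by (simp add: sum_distrib_left)
  also have "(\<Sum>i\<le>m. \<Sum>j\<le>m'. ?c i * ?d j * v (monom 1 (i + j))) = v (q m * q m')"
  proof -
    have "v (q m * q m') = (\<Sum>i\<le>m. \<Sum>j\<le>m'. v (monom (?c i * ?d j) (i + j)))"
      using arg_cong2[OF q_as_sum[of m] q_as_sum[of m'], of "\<lambda>a b. v (a * b)"]
      by (simp only: sum_product mult_monom moment_functional_sum[OF v_linear])
    moreover have "v (monom (?c i * ?d j) (i + j)) = ?c i * ?d j * v (monom 1 (i + j))" for i j
      using moment_functional_smult[OF v_linear, of "?c i * ?d j" "monom 1 (i + j)"]
      by (simp add: smult_monom)
    ultimately show ?thesis by simp
  qed
  finally show ?thesis .
qed

lemma w_K_orth:
  assumes "m \<le> n" "m' \<le> n'" "(n, m) \<noteq> (n', m')"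
  shows "w (K n m * K n' m') = 0"
proof (cases "m = m'")
  case True
  \<comment> \<open>Both minuends are at least \<open>m\<close>, so truncated subtraction keeps the
    indices distinct. The exponent \<open>m + m + 1\<close> is the one for which \<open>p m\<close>
    is orthogonal.\<close>
  then have "n - m \<noteq> n' - m" using assms by auto
  from p_orth[OF this, of m] show ?thesis
    unfolding w_K_mult using True by (simp add: mult_2)
qed (simp add: w_K_mult q_orth)

lemma w_K_square:
  "w (K n m * K n m) = L (2 * m + 1) (p m (n - m) * p m (n - m)) * v (q m * q m)"
  by (simp add: w_K_mult mult_2)

lemma w_K_norm: "w (K n m * K n m) \<noteq> 0"
  unfolding w_K_square using p_norm q_norm by simp

lemma coeff_K:
  "poly.coeff (K n m) j =
     (if j \<le> m then smult (poly.coeff (q m) j) (p m (n - m) * R (m - j)) else 0)"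
  by (simp add: K_def coeff_sum)

text \<open>The coefficient of y^k has degree at most (n-m) + (m-k) in x, which gives the upper
  bound. The term x^(n-m) y^m attains it, because \<open>R 0 = 1\<close>.\<close>

lemma total_degree_K:
  assumes "m \<le> n"
  shows "total_degree (K n m) = n"
proof (rule antisym)
  show "total_degree (K n m) \<le> n"
    unfolding total_degree_le_iff
  proof (intro allI impI)
    fix h k assume nz: "poly.coeff (poly.coeff (K n m) k) h \<noteq> 0"
    then have k: "k \<le> m" "poly.coeff (q m) k \<noteq> 0"
      by (auto simp: coeff_K split: if_splits)
    have "h \<le> degree (p m (n - m) * R (m - k))"
      using nz k by (intro le_degree) (simp add: coeff_K)
    also have "\<dots> \<le> (n - m) + (m - k)"
      using degree_mult_le[of "p m (n - m)" "R (m - k)"] R_degree[OF k] by (simp add: p_degree)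
    finally show "h + k \<le> n" using k assms by simp
  qed
  have "poly.coeff (poly.coeff (K n m) m) (n - m) \<noteq> 0"
    using q_lead p_nonzero[of m "n - m"] p_degree[of m "n - m"]
    by (simp add: coeff_K R_0) (metis leading_coeff_0_iff)
  \<comment> \<open>Taking the total degree itself as the bound, every nonzero coefficient bounds it
    from below.\<close>
  then have "n - m + m \<le> total_degree (K n m)"
    using total_degree_le_iff[of "K n m" "total_degree (K n m)"] by blast
  then show "n \<le> total_degree (K n m)" using assms by simp
qed

section \<open>Spanning, independence and Gram matrices\<close>

definition K_upto :: "nat \<Rightarrow> bipoly set" where
  "K_upto N = (\<lambda>(n, m). K n m) ` {(n, m). m \<le> n \<and> n \<le> N}"

lemma finite_K_upto: "finite (K_upto N)"
proof -
  have "{(n, m). m \<le> n \<and> n \<le> N} \<subseteq> {..N} \<times> {..N}" by auto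
  then show ?thesis unfolding K_upto_def by (intro finite_imageI) (auto intro: finite_subset)
qed

lemma K_upto_orth:
  assumes "b \<in> K_upto N" "b' \<in> K_upto N" "b \<noteq> b'"
  shows "w (b * b') = 0"
  using assms w_K_orth unfolding K_upto_def by auto

lemma K_upto_norm: "b \<in> K_upto N \<Longrightarrow> w (b * b) \<noteq> 0"
  using w_K_norm unfolding K_upto_def by auto

text \<open>The coefficient of \<open>y\<^sup>m\<close> in \<open>K n m\<close> is a nonzero multiple of \<open>p m (n - m)\<close>, so the
  top coefficient in \<open>y\<close> can be eliminated by expanding it in the sequence \<open>p m\<close>.\<close>

lemma span_K_upto_aux:
  assumes "\<And>j. j \<ge> k \<Longrightarrow> poly.coeff f j = 0" "total_degree f \<le> N"
  shows "f \<in> bi.span (K_upto N)"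
  using assms
proof (induction k arbitrary: f)
  case 0
  then have "f = 0" by (intro poly_eqI) simp
  then show ?case by (simp add: bi.span_zero)
next
  case (Suc k)
  show ?case
  proof (cases "k \<le> N")
    case False
    \<comment> \<open>A power of y beyond \<open>N\<close> is excluded by the total degree, so the
      induction hypothesis applies to \<open>f\<close> itself.\<close>
    have "poly.coeff f k = 0"
      using Suc.prems(2) False unfolding total_degree_le_iff
      by (intro poly_eqI) (metis add_leD2 coeff_0)
    then have "poly.coeff f j = 0" if "j \<ge> k" for j
      using Suc.prems(1) that by (cases "j = k") auto
    then show ?thesis using Suc by blast
  next
    case True
    have "degree (poly.coeff f k) \<le> N - k"
    proof (rule degree_le, clarify)
      fix h assume "N - k < h"
      then show "poly.coeff (poly.coeff f k) h = 0"
        using Suc.prems(2) unfolding total_degree_le_iff by (metis not_less less_diff_conv2 True)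
    qed
    then obtain c where c: "poly.coeff f k = (\<Sum>i\<le>N - k. smult (c i) (p k i))"
      using orthogonal_poly_seq_expand[OF moment_functional_L p_ops] by blast
    \<comment> \<open>The first index \<open>i + k\<close> makes the x-factor \<open>p k i\<close>,
      and the division removes the leading coefficient of \<open>q k\<close>. Thus \<open>g\<close>
      matches \<open>f\<close> at y^k and has no higher power of y; \<open>i \<le> N - k\<close>
      keeps its terms in \<open>K_upto N\<close>.\<close>
    define g where
      "g = (\<Sum>i\<le>N - k. bi_scale (c i / poly.coeff (q k) k) (K (i + k) k))"
    have g: "g \<in> bi.span (K_upto N)"
      unfolding g_def
    proof (intro bi.span_sum bi.span_scale bi.span_base)
      fix i assume "i \<in> {..N - k}"
      then have "(i + k, k) \<in> {(n, m). m \<le> n \<and> n \<le> N}" using True by auto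
      then show "K (i + k) k \<in> K_upto N" unfolding K_upto_def by force
    qed
    have "K_upto N \<subseteq> {f. total_degree f \<le> N}"
      by (auto simp: K_upto_def total_degree_K)
    then have "total_degree g \<le> N"
      using bi.span_minimal[OF _ subspace_total_degree_le] g by blast
    then have "total_degree (f - g) \<le> N"
      using bi.subspace_diff[OF subspace_total_degree_le, of f N g] Suc.prems(2) by simp
    moreover have "poly.coeff (f - g) j = 0" if "j \<ge> k" for j
    proof (cases "j = k")
      case True
      have "poly.coeff g k = (\<Sum>i\<le>N - k. smult (c i) (p k i))"
        using q_lead[of k] by (simp add: g_def coeff_sum coeff_bi_scale coeff_K R_0)
      then show ?thesis using c True by simp
    next
      case False
      then show ?thesis
        using that Suc.prems(1) by (simp add: g_def coeff_sum coeff_bi_scale coeff_K)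
    qed
    ultimately have "f - g \<in> bi.span (K_upto N)" using Suc.IH by blast
    from bi.span_add[OF this g] show ?thesis by simp
  qed
qed

lemma span_K_upto: "bi.span (K_upto N) = {f. total_degree f \<le> N}"
proof
  show "bi.span (K_upto N) \<subseteq> {f. total_degree f \<le> N}"
    by (rule bi.span_minimal[OF _ subspace_total_degree_le]) (auto simp: K_upto_def total_degree_K)
  show "{f. total_degree f \<le> N} \<subseteq> bi.span (K_upto N)"
  proof clarify
    fix f assume "total_degree f \<le> N"
    then show "f \<in> bi.span (K_upto N)"
      by (intro span_K_upto_aux[of "Suc (degree f)"]) (auto simp: coeff_eq_0)
  qed
qed

text \<open>Two equal entries with different indices would be orthogonal to themselves,
  contradicting the nonzero norms; the same facts give independence.\<close>

lemma polynomial_system_K: "polynomial_system K"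
proof -
  have "inj_on (\<lambda>(n, m). K n m) {(n, m). m \<le> n \<and> n \<le> N}" for N
  proof (rule inj_onI, clarify)
    fix n m n' m' assume *: "m \<le> n" "m' \<le> n'" "K n m = K n' m'"
    then show "n = n' \<and> m = m'" using w_K_orth[of m n m' n'] w_K_norm[of n m] by auto
  qed
  moreover have "\<not> bi.dependent (K_upto N)" for N
    using w_linear K_upto_orth K_upto_norm by (rule orthogonal_independent)
  ultimately show ?thesis
    using span_K_upto unfolding polynomial_system_def Let_def K_upto_def
    by (simp add: total_degree_K)
qed

lemma mutually_orthogonal_system_K: "mutually_orthogonal_system w K"
proof -
  have diag: "diagonal_mat (gram_mat w K n)" for n
    by (auto simp: diagonal_mat_def gram_mat_def w_K_orth)
  have "invertible_mat (gram_mat w K n)" for n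
  proof -
    \<comment> \<open>The Gram matrix is diagonal with nonzero entries, so the reciprocals form its
      inverse.\<close>
    let ?D = "mat (n + 1) (n + 1) (\<lambda>(i, j). if i = j then 1 / w (K n i * K n i) else 0)"
    let ?G = "mat (n + 1) (n + 1) (\<lambda>(i, j). if i = j then w (K n i * K n i) else 0)"
    have G: "gram_mat w K n = ?G"
      by (rule eq_matI) (auto simp: gram_mat_def w_K_orth)
    have "?G * ?D = 1\<^sub>m (n + 1)" "?D * ?G = 1\<^sub>m (n + 1)"
      by (rule eq_matI; auto simp: scalar_prod_def w_K_norm if_distrib[of "\<lambda>x. x * _"] cong: if_cong)+
    then show ?thesis
      unfolding G invertible_mat_def inverts_mat_def by (auto intro!: exI[of _ ?D])
  qed
  moreover have "transpose_mat (gram_mat w K n) = gram_mat w K n" for n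
    by (rule eq_matI) (auto simp: gram_mat_def mult.commute)
  ultimately show ?thesis
    using diag polynomial_system_K w_K_orth
    unfolding mutually_orthogonal_system_def orthogonal_system_def by auto
qed

section \<open>Identification of the family with its explicit form\<close>

lemma bi_eval_K:
  "bi_eval (K n m) x y = (\<Sum>j\<le>m. poly.coeff (q m) j * poly (p m (n - m)) x * poly (R (m - j)) x * y ^ j)"
  by (simp add: bi_eval_def K_def poly_sum poly_monom mult_ac)

lemma koornwinder_family_K: "koornwinder_family \<rho> p q K"
  unfolding koornwinder_family_def
proof (intro allI impI)
  fix n m :: nat and x y :: real assume nz: "\<rho> x \<noteq> 0"
  have "complex_of_real (bi_eval (K n m) x y) =
      (\<Sum>j\<le>m. complex_of_real (poly.coeff (q m) j) * complex_of_real (poly (p m (n - m)) x) *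
        complex_of_real (poly (R (m - j)) x) * complex_of_real y ^ j)"
    by (simp add: bi_eval_K)
  also have "\<dots> = (\<Sum>j\<le>m. complex_of_real (poly (p m (n - m)) x) * \<rho> x ^ m *
        (complex_of_real (poly.coeff (q m) j) * (complex_of_real y / \<rho> x) ^ j))"
  proof (intro sum.cong refl)
    fix j assume j: "j \<in> {..m}"
    let ?c = "complex_of_real (poly.coeff (q m) j)" and ?p = "complex_of_real (poly (p m (n - m)) x)"
      and ?y = "complex_of_real y"
    \<comment> \<open>Splitting off \<open>j\<close> of the \<open>m\<close> powers of \<rho> clears
      the denominators.\<close>
    have "\<rho> x ^ m * (?y / \<rho> x) ^ j = \<rho> x ^ (m - j) * (\<rho> x * (?y / \<rho> x)) ^ j"
      using j by (simp only: power_mult_distrib mult.assoc[symmetric] power_add[symmetric]) simp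
    then have *: "\<rho> x ^ m * (?y / \<rho> x) ^ j = \<rho> x ^ (m - j) * ?y ^ j"
      using nz by simp
    show "?c * ?p * complex_of_real (poly (R (m - j)) x) * ?y ^ j =
        ?p * \<rho> x ^ m * (?c * (?y / \<rho> x) ^ j)"
    proof (cases "poly.coeff (q m) j = 0")
      case False
      then have "?c * ?p * complex_of_real (poly (R (m - j)) x) * ?y ^ j =
          ?c * ?p * (\<rho> x ^ (m - j) * ?y ^ j)"
        using R_eval[of j m x] j by (simp add: mult.assoc)
      then show ?thesis unfolding *[symmetric] by (simp only: mult_ac)
    qed simp
  qed
  also have "\<dots> = complex_of_real (poly (p m (n - m)) x) * \<rho> x ^ m *
      poly (map_poly complex_of_real (q m)) (complex_of_real y / \<rho> x)"
    by (simp add: poly_altdef[of "map_poly _ _"] degree_map_poly coeff_map_poly q_degree sum_distrib_left)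
  finally show "complex_of_real (bi_eval (K n m) x y) = \<dots>" .
qed

text \<open>As \<rho> has finitely many zeros, the defining equation fixes the values for infinitely
  many x and all y.\<close>

lemma koornwinder_family_unique:
  assumes "koornwinder_family \<rho> p q P" "m \<le> n"
  shows "P n m = K n m"
proof (rule bi_eval_eqI)
  show "infinite {x. \<rho> x \<noteq> 0}"
  proof
    assume "finite {x. \<rho> x \<noteq> 0}"
    then have "finite ({x. \<rho> x \<noteq> 0} \<union> {x. \<rho> x = 0})"
      using finite_rho_zeros by simp
    also have "{x. \<rho> x \<noteq> 0} \<union> {x. \<rho> x = 0} = UNIV" by auto
    finally show False by (simp add: infinite_UNIV_char_0)
  qed
  fix x y assume "x \<in> {x. \<rho> x \<noteq> 0}"
  then have "complex_of_real (bi_eval (P n m) x y) = complex_of_real (bi_eval (K n m) x y)"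
    using assms koornwinder_family_K unfolding koornwinder_family_def by simp
  then show "bi_eval (P n m) x y = bi_eval (K n m) x y" by simp
qed

text \<open>Being a mutually orthogonal system involves only entries with \<open>m \<le> n\<close>,
  where \<open>P\<close> and \<open>K\<close> agree.\<close>

lemma koornwinder_family_mutually_orthogonal:
  assumes "koornwinder_family \<rho> p q P"
  shows "mutually_orthogonal_system w P"
proof -
  have eq: "P n m = K n m" if "m \<le> n" for n m :: nat
    using koornwinder_family_unique[OF assms that] .
  have "(\<lambda>(n, m). P n m) ` {(n, m). m \<le> n \<and> n \<le> N} = (\<lambda>(n, m). K n m) ` {(n, m). m \<le> n \<and> n \<le> N}"
    "inj_on (\<lambda>(n, m). P n m) {(n, m). m \<le> n \<and> n \<le> N} =
     inj_on (\<lambda>(n, m). K n m) {(n, m). m \<le> n \<and> n \<le> N}" for N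
    by (rule image_cong inj_on_cong; auto simp: eq)+
  moreover have "gram_mat w P n = gram_mat w K n" for n
    by (rule eq_matI) (auto simp: gram_mat_def eq)
  ultimately show ?thesis
    using mutually_orthogonal_system_K
    unfolding mutually_orthogonal_system_def orthogonal_system_def polynomial_system_def
    by (simp add: eq)
qed

lemma bi_quasi_definite_w: "bi_quasi_definite w"
  using w_linear mutually_orthogonal_system_K
  unfolding bi_quasi_definite_def mutually_orthogonal_system_def by blast

text \<open>Each norm factors into two positive values, and every \<open>f\<close> lies in the span
  of \<open>K_upto (total_degree f)\<close>.\<close>

lemma bi_positive_definite_w:
  assumes "\<And>m. positive_definite (L (2 * m + 1))" "positive_definite v"
  shows "bi_positive_definite w"
proof -
  have "w (b * b) > 0" if b: "b \<in> K_upto N" for b N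
  proof -
    obtain n m where "b = K n m"
      using b by (auto simp: K_upto_def)
    moreover have "L (2 * m + 1) (p m (n - m) * p m (n - m)) > 0" "v (q m * q m) > 0"
      using assms p_nonzero q_nonzero unfolding positive_definite_def power2_eq_square by blast+
    ultimately show ?thesis by (simp only: w_K_square mult_pos_pos)
  qed
  then have "w (f ^ 2) > 0" if "f \<noteq> 0" for f
    using orthogonal_span_positive[OF w_linear finite_K_upto[of "total_degree f"] _ that]
      K_upto_orth span_K_upto by blast
  then show ?thesis using w_linear by (simp add: bi_positive_definite_def)
qed

end

section \<open>Polynomial representatives of the powers of \<rho> in Cases I and II\<close>

theorem theorem3p1:
  fixes u :: "(real \<Rightarrow> complex) \<Rightarrow> real"
    and v :: "real poly \<Rightarrow> real"
    and \<rho> :: "real \<Rightarrow> complex"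
    and w :: "real poly poly \<Rightarrow> real"
    and p :: "nat \<Rightarrow> nat \<Rightarrow> real poly"
    and q :: "nat \<Rightarrow> real poly"
  assumes rho: "case_I \<rho> \<or> case_II \<rho> v"
    and u_linear: "real_linear_on (rho_space \<rho>) u"
    and u_qd: "quasi_definite (rho_pow_functional \<rho> 0 u)"
    and v_qd: "quasi_definite v"
    and um_qd: "\<forall>m. quasi_definite (rho_pow_functional \<rho> (2 * m + 1) u)"
    and w_linear: "bi_moment_functional w"
    and w_monom: "\<forall>h k. w (bi_monom h k) =
          rho_pow_functional \<rho> (k + 1) u (Polynomial.monom 1 h) * v (Polynomial.monom 1 k)"
    and p_ops: "\<forall>m. orthogonal_poly_seq (rho_pow_functional \<rho> (2 * m + 1) u) (p m)"
    and q_ops: "orthogonal_poly_seq v q"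
  shows "bi_quasi_definite w \<and>
    (\<exists>P. koornwinder_family \<rho> p q P) \<and>
    (\<forall>P. koornwinder_family \<rho> p q P \<longrightarrow> mutually_orthogonal_system w P) \<and>
    ((\<forall>m. positive_definite (rho_pow_functional \<rho> (2 * m + 1) u)) \<and> positive_definite v
       \<longrightarrow> bi_positive_definite w)"
proof -
  have v: "moment_functional v" using v_qd by (simp add: quasi_definite_def)
  have memI: "f \<in> rho_space \<rho>"
    if "\<And>x. f x = complex_of_real (poly a x) + \<rho> x * complex_of_real (poly b x)" for f a b
    using that unfolding rho_space_def by blast
  have "\<exists>R. koornwinder u v \<rho> w p q R"
    using rho
  proof
    assume "case_I \<rho>"
    then obtain r0 r1 where r: "\<bar>r1\<bar> + \<bar>r0\<bar> > 0" "\<And>x. \<rho> x = complex_of_real (r1 * x + r0)"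
      by (auto simp: case_I_def)
    let ?r = "[:r0, r1:]"
    have eval: "\<rho> x = complex_of_real (poly ?r x)" for x by (simp add: r)
    have "koornwinder u v \<rho> w p q (\<lambda>i. ?r ^ i)"
    proof (unfold_locales; (use u_linear v w_linear w_monom p_ops q_ops in blast)?)
      fix k a show "(\<lambda>x. \<rho> x ^ k * complex_of_real (poly a x)) \<in> rho_space \<rho>"
        \<comment> \<open>Here \<rho> is itself a polynomial, so the \<rho>-component can be taken
          to be zero.\<close>
        by (rule memI[of _ "?r ^ k * a" 0]) (simp add: eval del: poly_pCons)
    next
      have "?r \<noteq> 0" using r by auto
      then show "finite {x. \<rho> x = 0}" using poly_roots_finite[of ?r] by (simp add: eval del: poly_pCons)
    next
      fix m j x show "complex_of_real (poly (?r ^ (m - j)) x) = \<rho> x ^ (m - j)"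
        by (simp add: eval del: poly_pCons)
    next
      fix m j :: nat
      show "degree (?r ^ (m - j)) \<le> m - j"
        using degree_power_le[of ?r "m - j"] by (auto split: if_splits)
    qed
    then show ?thesis by blast
  next
    assume "case_II \<rho> v"
    then obtain s where s: "s \<noteq> 0" "degree s \<le> 2" "\<And>x. \<rho> x ^ 2 = complex_of_real (poly s x)"
      and sym: "symmetric_functional v"
      by (auto simp: case_II_def)
    have even_pow: "\<rho> x ^ (2 * k) = complex_of_real (poly (s ^ k) x)" for x k
      by (simp add: power_mult s)
    have par: "even (m - j)" if "j \<le> m" "poly.coeff (q m) j \<noteq> 0" for m j
      using symmetric_orthogonal_poly_parity[OF v q_ops sym] that by blast
    \<comment> \<open>For even \<open>i\<close> this is \<rho>^i, as \<rho>^2 is \<open>s\<close>.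
      For odd \<open>i\<close> it is a filler value: by \<open>par\<close> such exponents meet only
      zero coefficients of \<open>q m\<close>.\<close>
    have "koornwinder u v \<rho> w p q (\<lambda>i. s ^ (i div 2))"
    proof (unfold_locales; (use u_linear v w_linear w_monom p_ops q_ops in blast)?)
      fix k a show "(\<lambda>x. \<rho> x ^ k * complex_of_real (poly a x)) \<in> rho_space \<rho>"
      \<comment> \<open>Even powers of \<rho> are polynomials; an odd power is \<rho> times a
        polynomial.\<close>
      proof (cases "even k")
        case True
        then obtain l where "k = 2 * l" by auto
        then show ?thesis by (intro memI[of _ "s ^ l * a" 0]) (simp add: even_pow)
      next
        case False
        then obtain l where "k = 2 * l + 1" by (elim oddE)
        then show ?thesis by (intro memI[of _ 0 "s ^ l * a"]) (simp add: even_pow)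
      qed
    next
      have "{x. \<rho> x = 0} \<subseteq> {x. poly s x = 0}"
        using s(3) by (auto dest: arg_cong[of _ _ "\<lambda>z. z ^ 2"])
      then show "finite {x. \<rho> x = 0}" using poly_roots_finite[OF s(1)] finite_subset by blast
    next
      fix m j x assume "j \<le> m" "poly.coeff (q m) j \<noteq> 0"
      from par[OF this] show "complex_of_real (poly (s ^ ((m - j) div 2)) x) = \<rho> x ^ (m - j)"
        using even_pow[of x "(m - j) div 2"] by simp
    next
      fix m j :: nat
      \<comment> \<open>Halving the exponent offsets the degree of \<open>s\<close>, which is at
        most 2.\<close>
      have "degree (s ^ ((m - j) div 2)) \<le> degree s * ((m - j) div 2)" by (rule degree_power_le)
      also have "\<dots> \<le> 2 * ((m - j) div 2)" using s(2) by (rule mult_right_mono) simp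
      also have "\<dots> \<le> m - j" by simp
      finally show "degree (s ^ ((m - j) div 2)) \<le> m - j" .
    qed
    then show ?thesis by blast
  qed
  then obtain R where "koornwinder u v \<rho> w p q R" by blast
  then interpret koornwinder u v \<rho> w p q R .
  show ?thesis
    using bi_quasi_definite_w koornwinder_family_K koornwinder_family_mutually_orthogonal
      bi_positive_definite_w by blast
qed

end
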